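(* The restriction of the $MU_*$-module morphism $K:MU_*(\mathbb{CP}^\infty_0\wedge\mathbb{CP}^\infty_0)\to MU_*MU\otimes\mathbb{Q}[-4]$ to the primitive elements is determined by $$K(p_m\otimes p_n)=(\overline B^R_{m+1}-\overline B^L_{m+1})\,\overline B^R_{n+1}$$ for natural numbers $m,n$ (i.e. $m,n\ge0$).
   Context: $[a]$ denotes the shift $(V_*[a])_t=V_{t-a}$. $\mathbb{CP}^\infty_n$ is the Thom spectrum of $n\lambda$ over $\mathbb{CP}^\infty$, $\lambda$ the canonical line bundle. $MU_*(\mathbb{CP}^\infty_n)$ is $MU_*$-free on $\{\beta_i\mid i\ge n\}$; $\underline\beta_n(S)=\sum_{i\ge n}\beta_iS^i$; $MU_*(\mathbb{CP}^\infty_m\wedge\mathbb{CP}^\infty_n)\cong MU_*(\mathbb{CP}^\infty_m)\otimes_{MU_*}MU_*(\mathbb{CP}^\infty_n)$. A module morphism is "determined by" an assignment on a generating series if it sends each generator to the corresponding coefficient. $MU_*MU\otimes\mathbb{Q}$ carries two formal group laws, via the left and right units, with logarithms $\log^L,\log^R$ and exponentials $\exp^L,\exp^R$; $\underline b(x)=\sum_ib_ix^{i+1}=\exp^R\circ\log^L$ is the universal strict isomorphism, defined over $MU_*MU=MU_*[b_i\mid i\ge0,b_0=1]$. $MU_*(U):MU_*(\mathbb{CP}^\infty_{-1})\to MU_*\otimes\mathbb{Q}[-2]$ is induced by the rational Thom class $U:\mathbb{CP}^\infty_{-1}\to S^{-2}_{\mathbb{Q}}$; $\sigma:MU_*(\mathbb{CP}^\infty_0)\to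 MU_*(\mathbb{CP}^\infty_{-1})$ is the $MU_*$-linear section $\beta_i\mapsto\beta_i$. $E_\tau:MU_*(\mathbb{CP}^\infty_0\wedge\mathbb{CP}^\infty_0)\to MU_*MU\otimes_{MU_*}MU_*(\mathbb{CP}^\infty_0)[-2]$ is the cocycle representing the extension $0\to MU_*(\mathbb{CP}^\infty_0)[-2]\to MU_*(\mathbb{CP}^\infty_{-1}\wedge\mathbb{CP}^\infty_0)\to MU_*(\mathbb{CP}^\infty_0\wedge\mathbb{CP}^\infty_0)\to0$ defined from the section $\sigma'=\sigma\otimes\mathrm{id}$: it is $(\mathrm{id}\otimes r')\circ\psi\circ(-\sigma')$, where $\psi$ is the comodule structure and $r'$ the retract associated to $\sigma'$. The morphism $K$ is the composite $(MU_*MU\otimes(MU_*(U)\circ\sigma))\circ E_\tau$; explicitly it is determined by $$\underline\beta_0(S)\otimes\underline\beta_0(T)\mapsto\Big(\frac1S-\frac1{\underline b(S)}\Big)\Big(\frac1{\log^LT}-\frac1{\underline b(T)}\Big).$$ The comodule primitives $p_n\in MU_{2n}(\mathbb{CP}^\infty_0)$ are defined by $\underline\beta_0(\exp(T))=\sum_{n\ge0}\frac{p_n}{n!}T^n$ in $(MU_*(\mathbb{CP}^\infty_0)\otimes\mathbb{Q})[[T]]$, $\exp$ the exponential of the formal group law of $MU$; the elements $p_m\otimes p_n$ ($m,n\ge0$) form a basis of the rationalized primitives of $MU_*(\mathbb{CP}^\infty_0\wedge\mathbb{CP}^\infty_0)$. For a formal group law $F$ over $R$, define $B_n(F)\in R\otimes\mathbb{Q}$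 ($n\ge1$) by $\frac1{\exp^Fx}-\frac1x=\sum_{i\ge0}\frac{B_{i+1}(F)}{(i+1)!}x^i$, and $\overline B_n(F)=B_n(F)/n$. $\overline B_n^L,\overline B_n^R\in MU_*MU\otimes\mathbb{Q}$ are the reduced Bernoulli numbers of the formal group laws given by the left and right units. *)

theory Defs
  imports
    "HOL-Computational_Algebra.Formal_Power_Series"
    "HOL-Computational_Algebra.Formal_Laurent_Series"
    "HOL-Library.Poly_Mapping"
    "HOL-Library.FuncSet"
begin

text \<open>All series below have coefficients in commutative rings and leading term \<open>x\<close>, so neither the
  compositional inverse nor the reciprocal (a Laurent series) needs a coefficient field.\<close>

definition comp_inverse :: "'a::comm_ring_1 fps \<Rightarrow> 'a fps" where
  "comp_inverse f = (THE g. fps_nth g 0 = 0 \<and> f oo g = fps_X)"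

definition recip :: "'a::comm_ring_1 fps \<Rightarrow> 'a fls" where
  "recip f = fls_right_inverse (fps_to_fls f) 1"

definition int_power :: "'a::comm_ring_1 fps \<Rightarrow> int \<Rightarrow> 'a fls" where
  "int_power f j = (if j \<ge> 0 then fps_to_fls f ^ nat j else recip f ^ nat (- j))"

text \<open>By theorems of Milnor and Quillen, \<open>MU\<^sub>* \<otimes> \<rat>\<close> is the polynomial algebra on the coefficients
  \<open>m\<^sub>i\<close>, \<open>i \<ge> 1\<close>, of the logarithm of the universal formal group law, and \<open>MU\<^sub>*\<close> is the subring
  generated by the coefficients of that formal group law.
  Polynomials are elements of monoid algebras: the inner type \<open>nat \<Rightarrow>\<^sub>0 nat\<close> is the type of
  monomials, and the variable with index \<open>i\<close> stands for \<open>m\<^bsub>i+1\<^esub>\<close>, respectively \<open>b\<^bsub>i+1\<^esub>\<close>.\<close>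

type_synonym MUQ = "(nat \<Rightarrow>\<^sub>0 nat) \<Rightarrow>\<^sub>0 rat"
type_synonym MUMUQ = "(nat \<Rightarrow>\<^sub>0 nat) \<Rightarrow>\<^sub>0 MUQ"

definition poly_var :: "nat \<Rightarrow> (nat \<Rightarrow>\<^sub>0 nat) \<Rightarrow>\<^sub>0 'a::comm_ring_1" where
  "poly_var i = Poly_Mapping.single (Poly_Mapping.single i 1) 1"

definition generic_series :: "((nat \<Rightarrow>\<^sub>0 nat) \<Rightarrow>\<^sub>0 'a::comm_ring_1) fps" where
  "generic_series = Abs_fps (\<lambda>k. case k of 0 \<Rightarrow> 0 | Suc 0 \<Rightarrow> 1 | Suc (Suc i) \<Rightarrow> poly_var i)"

definition log_MU :: "MUQ fps" where
  "log_MU = generic_series"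

definition exp_MU :: "MUQ fps" where
  "exp_MU = comp_inverse log_MU"

text \<open>The coefficient of \<open>x\<^sup>i y\<^sup>j\<close> in \<open>exp (log x + log y)\<close>. Bivariate series are power series in \<open>y\<close>
  over power series in \<open>x\<close>; the terms with \<open>k > i + j\<close> vanish.\<close>
definition fgl_coeff :: "nat \<Rightarrow> nat \<Rightarrow> MUQ" where
  "fgl_coeff i j = (\<Sum>k\<le>i + j. fps_nth exp_MU k *
     fps_nth (fps_nth ((fps_const log_MU + Abs_fps (\<lambda>n. fps_const (fps_nth log_MU n))) ^ k) j) i)"

inductive_set MU :: "MUQ set" where
  MU_coeff: "fgl_coeff i j \<in> MU"
| MU_one: "1 \<in> MU"
| MU_diff: "x \<in> MU \<Longrightarrow> y \<in> MU \<Longrightarrow> x - y \<in> MU"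
| MU_mult: "x \<in> MU \<Longrightarrow> y \<in> MU \<Longrightarrow> x * y \<in> MU"

text \<open>Since \<open>MU\<^sub>*MU = MU\<^sub>*[b\<^sub>i]\<close> as a left \<open>MU\<^sub>*\<close>-algebra, the left unit is the inclusion of constants.\<close>
definition eta_L :: "MUQ \<Rightarrow> MUMUQ" where
  "eta_L c = Poly_Mapping.single 0 c"

definition b_series :: "MUMUQ fps" where
  "b_series = generic_series"

definition log_L :: "MUMUQ fps" where
  "log_L = Abs_fps (\<lambda>n. eta_L (fps_nth log_MU n))"

text \<open>The right unit is the ring homomorphism that sends the logarithm coefficientwise to
  \<open>log\<^sup>L \<circ> b\<^sup>-\<^sup>1\<close>, so that \<open>b\<close> is the strict isomorphism \<open>exp\<^sup>R \<circ> log\<^sup>L\<close>.\<close>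
definition eta_R :: "MUQ \<Rightarrow> MUMUQ" where
  "eta_R c = (\<Sum>mon\<in>Poly_Mapping.keys c.
     eta_L (Poly_Mapping.single 0 (Poly_Mapping.lookup c mon)) *
     (\<Prod>i\<in>Poly_Mapping.keys mon.
        fps_nth (log_L oo comp_inverse b_series) (i + 2) ^ Poly_Mapping.lookup mon i))"

definition log_R :: "MUMUQ fps" where
  "log_R = Abs_fps (\<lambda>n. eta_R (fps_nth log_MU n))"

definition exp_L :: "MUMUQ fps" where
  "exp_L = comp_inverse log_L"

definition exp_R :: "MUMUQ fps" where
  "exp_R = comp_inverse log_R"

text \<open>The free \<open>R\<close>-module on a set of generators is modelled by finitely supported functions with
  values in \<open>R\<close>; the generator \<open>\<beta>\<^sub>k\<close> is \<open>Poly_Mapping.single k 1\<close>. In particular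
  \<open>MU\<^sub>*(CP\<^sub>n) \<otimes> \<rat>\<close> consists of the elements of \<open>int \<Rightarrow>\<^sub>0 MUQ\<close> supported on \<open>{n..}\<close>, and
  \<open>MU\<^sub>*MU \<otimes>\<^bsub>MU\<^sub>*\<^esub> MU\<^sub>*(CP\<^sub>n) \<otimes> \<rat>\<close> of the elements of \<open>int \<Rightarrow>\<^sub>0 MUMUQ\<close> supported there,
  as a free left module on the \<open>1 \<otimes> \<beta>\<^sub>k\<close>; here \<open>x \<otimes> c \<beta>\<^sub>k = x \<eta>\<^sub>R(c) \<otimes> \<beta>\<^sub>k\<close>.
  Gradings and hence the shifts by -2 and -4 are left implicit: they do not affect underlying
  modules and maps.\<close>

definition smul :: "'r::comm_ring_1 \<Rightarrow> ('k \<Rightarrow>\<^sub>0 'r) \<Rightarrow> 'k \<Rightarrow>\<^sub>0 'r" where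
  "smul c z = Poly_Mapping.map ((*) c) z"

definition semilinear_extension ::
    "('r::comm_ring_1 \<Rightarrow> 's::comm_ring_1) \<Rightarrow> ('k \<Rightarrow> 'l \<Rightarrow>\<^sub>0 's) \<Rightarrow> ('k \<Rightarrow>\<^sub>0 'r) \<Rightarrow> 'l \<Rightarrow>\<^sub>0 's" where
  "semilinear_extension h f z =
     (\<Sum>k\<in>Poly_Mapping.keys z. smul (h (Poly_Mapping.lookup z k)) (f k))"

definition tensor ::
    "('k \<Rightarrow>\<^sub>0 'r::comm_ring_1) \<Rightarrow> ('l \<Rightarrow>\<^sub>0 'r) \<Rightarrow> ('k \<times> 'l) \<Rightarrow>\<^sub>0 'r" where
  "tensor x y = (\<Sum>k\<in>Poly_Mapping.keys x. \<Sum>l\<in>Poly_Mapping.keys y.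
     Poly_Mapping.single (k, l) (Poly_Mapping.lookup x k * Poly_Mapping.lookup y l))"

definition MU_CP :: "int \<Rightarrow> (int \<Rightarrow>\<^sub>0 MUQ) set" where
  "MU_CP n = {z. Poly_Mapping.keys z \<subseteq> {n..} \<and> (\<forall>k. Poly_Mapping.lookup z k \<in> MU)}"

definition MU_CP_CP :: "int \<Rightarrow> int \<Rightarrow> ((int \<times> int) \<Rightarrow>\<^sub>0 MUQ) set" where
  "MU_CP_CP m n =
     {z. Poly_Mapping.keys z \<subseteq> {m..} \<times> {n..} \<and> (\<forall>k. Poly_Mapping.lookup z k \<in> MU)}"

text \<open>The coaction on \<open>MU\<^sub>*(CP\<^sub>n)\<close> sends the series \<open>\<Sum>\<^bsub>j\<ge>n\<^esub> \<beta>\<^sub>j S\<^sup>j\<close> to \<open>\<Sum>\<^bsub>j\<ge>n\<^esub> b(S)\<^sup>j \<otimes> \<beta>\<^sub>j\<close>;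
  the following is the coefficient of \<open>S\<^sup>k\<close>, to which only \<open>j \<le> k\<close> contribute.\<close>
definition coaction_gen :: "int \<Rightarrow> int \<Rightarrow> int \<Rightarrow>\<^sub>0 MUMUQ" where
  "coaction_gen n k =
     (\<Sum>j\<in>{n..k}. Poly_Mapping.single j (fls_nth (int_power b_series j) k))"

definition coaction_smash ::
    "int \<Rightarrow> int \<Rightarrow> ((int \<times> int) \<Rightarrow>\<^sub>0 MUQ) \<Rightarrow> (int \<times> int) \<Rightarrow>\<^sub>0 MUMUQ" where
  "coaction_smash m n =
     semilinear_extension eta_L (\<lambda>(i, j). tensor (coaction_gen m i) (coaction_gen n j))"

text \<open>The rational Thom class: \<open>\<Sum>\<^bsub>j\<ge>-1\<^esub> \<beta>\<^sub>j S\<^sup>j\<close> is sent to \<open>1 / log S\<close>.\<close>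
definition thom_U :: "(int \<Rightarrow>\<^sub>0 MUQ) \<Rightarrow> MUQ" where
  "thom_U z = (\<Sum>k\<in>Poly_Mapping.keys z. Poly_Mapping.lookup z k * fls_nth (recip log_MU) k)"

definition sigma :: "(int \<Rightarrow>\<^sub>0 MUQ) \<Rightarrow> int \<Rightarrow>\<^sub>0 MUQ" where
  "sigma = semilinear_extension id (\<lambda>i. Poly_Mapping.single i 1)"

definition sigma' :: "((int \<times> int) \<Rightarrow>\<^sub>0 MUQ) \<Rightarrow> (int \<times> int) \<Rightarrow>\<^sub>0 MUQ" where
  "sigma' = semilinear_extension id
     (\<lambda>(i, j). tensor (sigma (Poly_Mapping.single i 1)) (Poly_Mapping.single j 1))"

text \<open>The inclusion of the bottom cell of the first factor sends \<open>\<beta>\<^sub>j\<close> to \<open>\<beta>\<^sub>-\<^sub>1 \<otimes> \<beta>\<^sub>j\<close>; the retract of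
  it associated to \<open>\<sigma>'\<close> is the one whose kernel is the image of \<open>\<sigma>'\<close>.\<close>
definition retract :: "((int \<times> int) \<Rightarrow>\<^sub>0 MUQ) \<Rightarrow> int \<Rightarrow>\<^sub>0 MUQ" where
  "retract = semilinear_extension id
     (\<lambda>(i, j). if i = - 1 then Poly_Mapping.single j 1 else 0)"

text \<open>The map \<open>MU\<^sub>*MU \<otimes>\<^bsub>MU\<^sub>*\<^esub> f\<close>.\<close>
definition extend_scalars ::
    "(('k \<Rightarrow>\<^sub>0 MUQ) \<Rightarrow> 'l \<Rightarrow>\<^sub>0 MUQ) \<Rightarrow> ('k \<Rightarrow>\<^sub>0 MUMUQ) \<Rightarrow> 'l \<Rightarrow>\<^sub>0 MUMUQ" where
  "extend_scalars f =
     semilinear_extension id (\<lambda>k. Poly_Mapping.map eta_R (f (Poly_Mapping.single k 1)))"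

text \<open>The same for a functional, with \<open>MU\<^sub>*MU \<otimes>\<^bsub>MU\<^sub>*\<^esub> (MU\<^sub>* \<otimes> \<rat>) = MU\<^sub>*MU \<otimes> \<rat>\<close>.\<close>
definition extend_scalars_functional ::
    "(('k \<Rightarrow>\<^sub>0 MUQ) \<Rightarrow> MUQ) \<Rightarrow> ('k \<Rightarrow>\<^sub>0 MUMUQ) \<Rightarrow> MUMUQ" where
  "extend_scalars_functional f z = (\<Sum>k\<in>Poly_Mapping.keys z.
     Poly_Mapping.lookup z k * eta_R (f (Poly_Mapping.single k 1)))"

definition E_tau :: "((int \<times> int) \<Rightarrow>\<^sub>0 MUQ) \<Rightarrow> int \<Rightarrow>\<^sub>0 MUMUQ" where
  "E_tau z = extend_scalars retract (coaction_smash (- 1) 0 (- sigma' z))"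

definition K :: "((int \<times> int) \<Rightarrow>\<^sub>0 MUQ) \<Rightarrow> MUMUQ" where
  "K = restrict (\<lambda>z. extend_scalars_functional (thom_U \<circ> sigma) (E_tau z)) (MU_CP_CP 0 0)"

text \<open>Coefficient extraction from \<open>\<Sum>\<^sub>i \<beta>\<^sub>i (exp T)\<^sup>i = \<Sum>\<^sub>n p\<^sub>n T\<^sup>n / n!\<close>; the terms with \<open>i > n\<close> vanish.\<close>
definition prim :: "nat \<Rightarrow> int \<Rightarrow>\<^sub>0 MUQ" where
  "prim n = (\<Sum>i\<le>n. Poly_Mapping.single (int i) (of_nat (fact n) * fps_nth (exp_MU ^ i) n))"

text \<open>Bernoulli numbers of the formal group law with exponential \<open>e\<close>, for \<open>n \<ge> 1\<close>.\<close>
definition bernoulli_fgl :: "MUMUQ fps \<Rightarrow> nat \<Rightarrow> MUMUQ" where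
  "bernoulli_fgl e n = of_nat (fact n) * fls_nth (recip e - recip fps_X) (int n - 1)"

definition reduced_bernoulli_fgl :: "MUMUQ fps \<Rightarrow> nat \<Rightarrow> MUMUQ" where
  "reduced_bernoulli_fgl e n =
     eta_L (Poly_Mapping.single 0 (1 / of_nat n)) * bernoulli_fgl e n"

lemma left_comp_inverse_exists:
  fixes f :: "'a::idom fps"
  assumes f0: "fps_nth f 0 = 0" and f1: "fps_nth f 1 = 1"
  shows "\<exists>h. fps_nth h 0 = 0 \<and> fps_nth h 1 = 1 \<and> h oo f = fps_X"
proof -
  define step where "step h n = fps_nth fps_X n - (\<Sum>i<n. h i * fps_nth (f ^ i) n)" for h :: "nat \<Rightarrow> 'a" and n
  define c where "c = wfrec less_than (\<lambda>h n. step h n)"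
  have c: "c n = step c n" for n
  proof -
    have "c n = step (cut c less_than n) n"
      unfolding c_def by (subst wfrec) auto
    also have "\<dots> = step c n"
      unfolding step_def by (intro arg_cong2[where f=minus] refl sum.cong) (auto simp: cut_def)
    finally show ?thesis .
  qed
  define h where "h = Abs_fps c"
  have "fps_nth (h oo f) n = fps_nth fps_X n" for n
  proof -
    have "{0..n} = insert n {..<n}" by auto
    then have "fps_nth (h oo f) n = c n * fps_nth (f ^ n) n + (\<Sum>i<n. c i * fps_nth (f ^ i) n)"
      by (simp add: fps_compose_nth h_def)
    moreover have "fps_nth (f ^ n) n = 1"
      using startsby_zero_power_nth_same[OF f0, of n] f1 by simp
    ultimately show ?thesis using c[of n] by (simp add: step_def)
  qed
  then have 1: "h oo f = fps_X" by (simp add: fps_eq_iff)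
  have "fps_nth h 0 = 0" using c[of 0] by (simp add: h_def step_def)
  moreover have "fps_nth h 1 = 1" using c[of 1] c[of 0] by (simp add: h_def step_def)
  ultimately show ?thesis using 1 by blast
qed

lemma comp_inverse_works:
  fixes f :: "'a::idom fps"
  assumes f0: "fps_nth f 0 = 0" and f1: "fps_nth f 1 = 1"
  shows "fps_nth (comp_inverse f) 0 = 0" "fps_nth (comp_inverse f) 1 = 1"
    "f oo comp_inverse f = fps_X" "comp_inverse f oo f = fps_X"
proof -
  obtain h where h: "fps_nth h 0 = 0" "fps_nth h 1 = 1" "h oo f = fps_X"
    using left_comp_inverse_exists[OF assms] by blast
  obtain k where k: "fps_nth k 0 = 0" "fps_nth k 1 = 1" "k oo h = fps_X"
    using left_comp_inverse_exists[OF h(1,2)] by blast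
  have "k = k oo (h oo f)" by (simp add: h)
  also have "\<dots> = f" using k by (simp add: fps_compose_assoc f0 h(1) fps_X_fps_compose_startby0)
  finally have fh: "f oo h = fps_X" using k by simp
  have uniq: "g = h" if "fps_nth g 0 = 0" "f oo g = fps_X" for g
  proof -
    have "h = h oo (f oo g)" by (simp add: that)
    also have "\<dots> = (h oo f) oo g" by (rule fps_compose_assoc[OF that(1) f0])
    also have "\<dots> = g" using that(1) by (simp add: h(3) fps_X_fps_compose_startby0)
    finally show ?thesis by simp
  qed
  have "comp_inverse f = h"
    unfolding comp_inverse_def by (rule the_equality) (use h(1) fh in simp, use uniq in blast)
  then show "fps_nth (comp_inverse f) 0 = 0" "fps_nth (comp_inverse f) 1 = 1"
    "f oo comp_inverse f = fps_X" "comp_inverse f oo f = fps_X" using h fh by auto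
qed

lemma recip_mult:
  fixes f :: "'a::idom fps"
  assumes f0: "fps_nth f 0 = 0" and f1: "fps_nth f 1 = 1"
  shows "fps_to_fls f * recip f = 1"
proof -
  have "f \<noteq> 0" using f1 by auto
  have "subdegree f = 1"
    by (rule subdegreeI) (use assms in auto)
  then have "fls_nth (fps_to_fls f) (fls_subdegree (fps_to_fls f)) = 1"
    using f1 by (simp add: fls_subdegree_fls_to_fps)
  then show ?thesis unfolding recip_def by (intro fls_right_inverse) simp
qed

lemma generic_series_nth [simp]:
  "fps_nth generic_series 0 = 0" "fps_nth generic_series (Suc 0) = 1"
  "fps_nth generic_series (Suc (Suc i)) = poly_var i"
  by (simp_all add: generic_series_def)

lemma eta_L_simps [simp]:
  "eta_L 0 = 0" "eta_L 1 = 1" "eta_L (a + b) = eta_L a + eta_L b"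
  "eta_L (a * b) = eta_L a * eta_L b" "eta_L (- a) = - eta_L a"
  by (simp_all add: eta_L_def single_add mult_single single_uminus)

lemma eta_R_simps [simp]: "eta_R 0 = 0" "eta_R 1 = 1"
  "eta_R (poly_var i) = fps_nth (log_L oo comp_inverse b_series) (i + 2)"
  by (simp_all add: eta_R_def poly_var_def)

lemma log_L_nth [simp]: "fps_nth log_L 0 = 0" "fps_nth log_L (Suc 0) = 1"
  by (simp_all add: log_L_def log_MU_def)

lemma log_R_eq: "log_R = log_L oo comp_inverse b_series"
proof (rule fps_ext)
  fix n
  have b: "fps_nth (comp_inverse b_series) 0 = 0" "fps_nth (comp_inverse b_series) 1 = 1"
    by (intro comp_inverse_works; simp add: b_series_def)+
  show "fps_nth log_R n = fps_nth (log_L oo comp_inverse b_series) n"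
  proof (cases n)
    case 0 then show ?thesis by (simp add: log_R_def log_MU_def)
  next
    case (Suc k)
    then show ?thesis using b
      by (cases k) (simp_all add: log_R_def log_MU_def fps_compose_nth)
  qed
qed

lemma log_R_nth [simp]: "fps_nth log_R 0 = 0" "fps_nth log_R (Suc 0) = 1"
  by (simp_all add: log_R_def log_MU_def)

lemma b_series_nth [simp]: "fps_nth b_series 0 = 0" "fps_nth b_series (Suc 0) = 1"
  by (simp_all add: b_series_def)

lemma log_R_b: "log_R oo b_series = log_L"
  using comp_inverse_works[of b_series]
  by (simp add: log_R_eq fps_compose_assoc[symmetric])

lemma b_series_eq: "b_series = exp_R oo log_L"
proof -
  have "exp_R oo (log_R oo b_series) = b_series"
    using comp_inverse_works[of log_R]
    by (simp add: exp_R_def fps_compose_assoc fps_X_fps_compose_startby0)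
  then show ?thesis by (simp add: log_R_b)
qed

lemma lookup_smul [simp]: "Poly_Mapping.lookup (smul c x) k = c * Poly_Mapping.lookup x k"
  by (simp add: smul_def map.rep_eq when_def)

lemma smul_simps [simp]: "smul c 0 = 0" "smul c (x + y) = smul c x + smul c y"
  "smul (c + d) x = smul c x + smul d x" "smul 0 x = 0" "smul 1 x = x"
  "smul c (Poly_Mapping.single k d) = Poly_Mapping.single k (c * d)" "smul (- c) x = - smul c x"
  by (simp_all add: poly_mapping_eq_iff fun_eq_iff lookup_add distrib_left distrib_right lookup_single when_def)

lemma map_zero: "Poly_Mapping.map h 0 = 0"
  by (rule poly_mapping_eqI) (simp add: map.rep_eq)

lemma semilinear_extension_superset:
  assumes "h 0 = 0" "finite A" "Poly_Mapping.keys z \<subseteq> A"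
  shows "semilinear_extension h f z = (\<Sum>k\<in>A. smul (h (Poly_Mapping.lookup z k)) (f k))"
  unfolding semilinear_extension_def
  by (rule sum.mono_neutral_left) (use assms in \<open>auto simp: in_keys_iff\<close>)

lemma semilinear_extension_single:
  assumes "h 0 = 0"
  shows "semilinear_extension h f (Poly_Mapping.single k c) = smul (h c) (f k)"
  by (subst semilinear_extension_superset[where A = "{k}"]) (use assms in auto)

lemma semilinear_extension_add:
  assumes "h 0 = 0" "\<And>a b. h (a + b) = h a + h b"
  shows "semilinear_extension h f (x + y) = semilinear_extension h f x + semilinear_extension h f y"
  using assms keys_add[of x y]
  by (simp add: semilinear_extension_superset[where A = "Poly_Mapping.keys x \<union> Poly_Mapping.keys y"]
      lookup_add sum.distrib)

lemma semilinear_extension_sum: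
  assumes "h 0 = 0" "\<And>a b. h (a + b) = h a + h b"
  shows "semilinear_extension h f (sum g A) = (\<Sum>a\<in>A. semilinear_extension h f (g a))"
  by (induction A rule: infinite_finite_induct)
    (simp_all add: semilinear_extension_add assms, simp_all add: semilinear_extension_def)

lemma sum_singles: "finite A \<Longrightarrow> Poly_Mapping.lookup (\<Sum>a\<in>A. Poly_Mapping.single a (g a)) k = (if k \<in> A then g k else 0)"
  by (simp add: lookup_sum lookup_single when_def)

lemma tensor_sum_singles:
  assumes "finite A" "finite B"
  shows "tensor (\<Sum>a\<in>A. Poly_Mapping.single a (g a)) (\<Sum>b\<in>B. Poly_Mapping.single b (h b))
    = (\<Sum>a\<in>A. \<Sum>b\<in>B. Poly_Mapping.single (a, b) (g a * h b))" (is "tensor ?x ?y = _")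
proof -
  have kx: "Poly_Mapping.keys ?x \<subseteq> A" and ky: "Poly_Mapping.keys ?y \<subseteq> B"
    using assms by (auto simp: in_keys_iff sum_singles split: if_splits)
  have "tensor ?x ?y = (\<Sum>k\<in>A. \<Sum>l\<in>Poly_Mapping.keys ?y. Poly_Mapping.single (k, l)
     (Poly_Mapping.lookup ?x k * Poly_Mapping.lookup ?y l))"
    unfolding tensor_def using kx assms by (intro sum.mono_neutral_left) (auto simp: in_keys_iff)
  also have "\<dots> = (\<Sum>k\<in>A. \<Sum>l\<in>B. Poly_Mapping.single (k, l)
     (Poly_Mapping.lookup ?x k * Poly_Mapping.lookup ?y l))"
    using ky assms by (intro sum.cong sum.mono_neutral_left refl) (auto simp: in_keys_iff)
  also have "\<dots> = (\<Sum>a\<in>A. \<Sum>b\<in>B. Poly_Mapping.single (a, b) (g a * h b))"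
    using assms by (intro sum.cong refl) (simp add: sum_singles)
  finally show ?thesis .
qed

lemma tensor_single: "tensor (Poly_Mapping.single a c) (Poly_Mapping.single b d)
    = Poly_Mapping.single (a, b) (c * d)"
  using tensor_sum_singles[of "{a}" "{b}" "\<lambda>_. c" "\<lambda>_. d"] by simp

lemma extend_scalars_functional_sum_singles:
  assumes "finite A"
  shows "extend_scalars_functional f (\<Sum>a\<in>A. Poly_Mapping.single a (g a)) =
    (\<Sum>a\<in>A. g a * eta_R (f (Poly_Mapping.single a 1)))"
proof -
  have "extend_scalars_functional f (\<Sum>a\<in>A. Poly_Mapping.single a (g a)) =
    (\<Sum>k\<in>A. Poly_Mapping.lookup (\<Sum>a\<in>A. Poly_Mapping.single a (g a)) k * eta_R (f (Poly_Mapping.single k 1)))"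
    unfolding extend_scalars_functional_def
    by (rule sum.mono_neutral_left) (use assms in \<open>auto simp: in_keys_iff sum_singles split: if_splits\<close>)
  then show ?thesis using assms by (simp add: sum_singles)
qed

lemma uminus_sum_single: "- (\<Sum>a\<in>A. Poly_Mapping.single a (g a)) = (\<Sum>a\<in>A. Poly_Mapping.single a (- g a))"
  by (simp add: sum_negf single_uminus)

lemma E_tau_single:
  assumes "i \<ge> 0"
  shows "E_tau (Poly_Mapping.single (i, j) 1) = (\<Sum>l\<in>{0..j}. Poly_Mapping.single l
     (- fls_nth (recip b_series) i * fls_nth (int_power b_series l) j))"
proof -
  have s: "- sigma' (Poly_Mapping.single (i, j) 1) = Poly_Mapping.single (i, j) (- 1)"
    by (simp add: sigma'_def sigma_def semilinear_extension_single tensor_single single_uminus)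
  have r: "extend_scalars retract (Poly_Mapping.single (k, l) c) = (if k = -1 then Poly_Mapping.single l c else 0)"
    for k l :: int and c
    by (auto simp add: extend_scalars_def retract_def semilinear_extension_single map_zero)
  have "coaction_smash (- 1) 0 (- sigma' (Poly_Mapping.single (i, j) 1)) =
      - (\<Sum>a\<in>{-1..i}. \<Sum>b\<in>{0..j}. Poly_Mapping.single (a, b)
          (fls_nth (int_power b_series a) i * fls_nth (int_power b_series b) j))"
    unfolding s coaction_smash_def coaction_gen_def
    by (simp add: semilinear_extension_single tensor_sum_singles)
  also have "\<dots> = (\<Sum>a\<in>{-1..i}. \<Sum>b\<in>{0..j}. Poly_Mapping.single (a, b)
          (- (fls_nth (int_power b_series a) i * fls_nth (int_power b_series b) j)))"
    by (simp add: sum_negf single_uminus)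
  finally have "E_tau (Poly_Mapping.single (i, j) 1) = (\<Sum>a\<in>{-1..i}. \<Sum>b\<in>{0..j}. 
      extend_scalars retract (Poly_Mapping.single (a, b)
          (- (fls_nth (int_power b_series a) i * fls_nth (int_power b_series b) j))))"
    unfolding E_tau_def by (simp add: extend_scalars_def semilinear_extension_sum)
  also have "\<dots> = (\<Sum>a\<in>{-1..i}. if a = -1 then \<Sum>b\<in>{0..j}. Poly_Mapping.single b
          (- (fls_nth (int_power b_series a) i * fls_nth (int_power b_series b) j)) else 0)"
    unfolding r by (intro sum.cong refl) auto
  also have "\<dots> = (\<Sum>b\<in>{0..j}. Poly_Mapping.single b
          (- (fls_nth (int_power b_series (-1)) i * fls_nth (int_power b_series b) j)))"
    using assms by (subst sum.delta) auto
  finally show ?thesis by (simp add: int_power_def)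
qed

lemma eta_R_superset:
  assumes "finite A" "Poly_Mapping.keys c \<subseteq> A"
  shows "eta_R c = (\<Sum>mon\<in>A. eta_L (Poly_Mapping.single 0 (Poly_Mapping.lookup c mon)) *
     (\<Prod>i\<in>Poly_Mapping.keys mon.
        fps_nth (log_L oo comp_inverse b_series) (i + 2) ^ Poly_Mapping.lookup mon i))"
  unfolding eta_R_def
  by (rule sum.mono_neutral_left) (use assms in \<open>auto simp: in_keys_iff\<close>)

lemma eta_R_add: "eta_R (c + d) = eta_R c + eta_R d"
  using keys_add[of c d]
  by (simp add: eta_R_superset[where A = "Poly_Mapping.keys c \<union> Poly_Mapping.keys d"]
      lookup_add sum.distrib single_add algebra_simps)

lemma eta_R_sum: "eta_R (sum f A) = (\<Sum>a\<in>A. eta_R (f a))"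
  by (induction A rule: infinite_finite_induct) (simp_all add: eta_R_add)

lemma eta_R_single: "eta_R (Poly_Mapping.single mon q) =
    eta_L (Poly_Mapping.single 0 q) * (\<Prod>i\<in>Poly_Mapping.keys mon.
        fps_nth (log_L oo comp_inverse b_series) (i + 2) ^ Poly_Mapping.lookup mon i)"
  by (subst eta_R_superset[where A = "{mon}"]) auto

lemma monomial_mult:
  fixes r :: "nat \<Rightarrow> 'a::comm_ring_1"
  shows "(\<Prod>i\<in>Poly_Mapping.keys (m + n). r i ^ Poly_Mapping.lookup (m + n) i) =
    (\<Prod>i\<in>Poly_Mapping.keys m. r i ^ Poly_Mapping.lookup m i) *
    (\<Prod>i\<in>Poly_Mapping.keys n. r i ^ Poly_Mapping.lookup n i)"
proof -
  let ?A = "Poly_Mapping.keys m \<union> Poly_Mapping.keys n"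
  have *: "(\<Prod>i\<in>Poly_Mapping.keys x. r i ^ Poly_Mapping.lookup x i) = (\<Prod>i\<in>?A. r i ^ Poly_Mapping.lookup x i)"
    if "Poly_Mapping.keys x \<subseteq> ?A" for x
    by (rule prod.mono_neutral_left) (use that in \<open>auto simp: in_keys_iff\<close>)
  show ?thesis
    using keys_add[of m n]
    by (subst (1 2 3) *) (auto simp: lookup_add power_add prod.distrib)
qed

lemma sum_monomials: "(\<Sum>k\<in>Poly_Mapping.keys x. Poly_Mapping.single k (Poly_Mapping.lookup x k)) = x"
  by (rule poly_mapping_eqI) (simp add: sum_singles in_keys_iff)

lemma eta_R_mult: "eta_R (c * d) = eta_R c * eta_R d"
proof -
  have m: "eta_R (Poly_Mapping.single k q * Poly_Mapping.single l r) =
     eta_R (Poly_Mapping.single k q) * eta_R (Poly_Mapping.single l r)" for k l q r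
  proof -
    have "eta_L (Poly_Mapping.single 0 (q * r)) = eta_L (Poly_Mapping.single 0 q) * eta_L (Poly_Mapping.single 0 r)"
      by (simp add: mult_single flip: eta_L_simps(4))
    then show ?thesis
      unfolding mult_single eta_R_single monomial_mult by (simp add: ac_simps)
  qed
  have "c * d = (\<Sum>k\<in>Poly_Mapping.keys c. Poly_Mapping.single k (Poly_Mapping.lookup c k)) *
      (\<Sum>l\<in>Poly_Mapping.keys d. Poly_Mapping.single l (Poly_Mapping.lookup d l))"
    by (simp add: sum_monomials)
  then have "eta_R (c * d) = eta_R (\<Sum>k\<in>Poly_Mapping.keys c. Poly_Mapping.single k (Poly_Mapping.lookup c k)) *
      eta_R (\<Sum>l\<in>Poly_Mapping.keys d. Poly_Mapping.single l (Poly_Mapping.lookup d l))"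
    by (simp add: sum_product eta_R_sum m)
  then show ?thesis by (simp add: sum_monomials)
qed

lemma recip_unit_part:
  fixes f :: "'a::idom fps"
  assumes f0: "fps_nth f 0 = 0" and f1: "fps_nth f 1 = 1" and v: "fps_shift 1 f * v = 1"
  shows "recip f = fls_X_inv * fps_to_fls v"
proof -
  have f: "f = fps_X * fps_shift 1 f"
    by (rule fps_ext) (auto simp: f0)
  have "fps_to_fls f * (fls_X_inv * fps_to_fls v) = fls_X * fls_X_inv * fps_to_fls (fps_shift 1 f * v)"
    by (subst f) (simp add: fls_times_fps_to_fls ac_simps)
  also have "\<dots> = 1" unfolding v by (simp add: fls_X_times_conv_shift)
  finally have "fps_to_fls f * (fls_X_inv * fps_to_fls v) = fps_to_fls f * recip f"
    using recip_mult[OF f0 f1] by simp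
  moreover have "fps_to_fls f \<noteq> 0" using f1 by auto
  ultimately show ?thesis by simp
qed

lemma unit_part_inverse:
  fixes f :: "'a::idom fps"
  assumes f1: "fps_nth f 1 = 1"
  obtains v where "fps_shift 1 f * v = 1" "fps_nth v 0 = 1"
proof
  show "fps_shift 1 f * fps_right_inverse (fps_shift 1 f) 1 = 1"
    by (rule fps_right_inverse) (use f1 in simp)
qed simp

lemma X_inv_nth: "fls_nth (fls_X_inv * fps_to_fls v) k = (if k < -1 then 0 else fps_nth v (nat (k + 1)))"
  for v :: "'a::comm_ring_1 fps"
  by (simp add: fls_X_inv_times_conv_shift)

lemma recip_algebra:
  fixes L B V l b :: "'a::comm_ring_1"
  assumes 1: "L * (1 + B * V) = B" and 2: "B * b = 1" and 3: "L * l = 1"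
  shows "b + V = l"
proof -
  have "b + V = b + (B * b) * V" by (simp add: 2)
  also have "\<dots> = (L * l) * (b * (1 + B * V))" by (simp add: 3 algebra_simps)
  also have "\<dots> = l * b * (L * (1 + B * V))" by (simp add: ac_simps)
  also have "\<dots> = l * (B * b)" by (simp add: 1 ac_simps)
  finally show ?thesis by (simp add: 2)
qed

lemma K_generating_function:
  "extend_scalars_functional (thom_U \<circ> sigma) (E_tau (Poly_Mapping.single (int i, int j) 1)) =
     fls_nth (recip fps_X - recip b_series) (int i) *
     fls_nth (recip log_L - recip b_series) (int j)"
proof -
  have log: "fps_nth log_MU 0 = 0" "fps_nth log_MU 1 = 1" by (simp_all add: log_MU_def)
  obtain v where v: "fps_shift 1 log_MU * v = 1" "fps_nth v 0 = 1" using unit_part_inverse log(2) by blast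
  define vR where "vR = Abs_fps (\<lambda>n. eta_R (fps_nth v n))"
  define V where "V = fps_shift 1 vR"
  have vR: "fps_shift 1 log_R * vR = 1"
  proof (rule fps_ext)
    fix n
    have "fps_nth (fps_shift 1 log_R * vR) n = eta_R (fps_nth (fps_shift 1 log_MU * v) n)"
      by (simp add: fps_mult_nth eta_R_sum eta_R_mult log_R_def vR_def)
    then show "fps_nth (fps_shift 1 log_R * vR) n = fps_nth 1 n" unfolding v by simp
  qed
  have vRV: "vR = 1 + fps_X * V"
    by (rule fps_ext) (auto simp: V_def vR_def v)
  have b0: "fps_nth b_series 0 = 0" by simp
  have logR: "log_R = fps_X * fps_shift 1 log_R" by (rule fps_ext) auto
  have "log_L = (fps_X * fps_shift 1 log_R) oo b_series" using log_R_b logR by simp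
  then have logL: "log_L = b_series * (fps_shift 1 log_R oo b_series)"
    by (simp add: fps_compose_mult_distrib[OF b0] fps_X_fps_compose_startby0)
  have "(fps_shift 1 log_R * (1 + fps_X * V)) oo b_series = 1"
    using vR vRV by simp
  then have "(fps_shift 1 log_R oo b_series) * (1 + b_series * (V oo b_series)) = 1"
    by (simp add: fps_compose_mult_distrib[OF b0] fps_compose_add_distrib fps_X_fps_compose_startby0)
  then have "log_L * (1 + b_series * (V oo b_series)) = b_series"
    unfolding logL by (simp add: mult.assoc)
  from arg_cong[OF this, of fps_to_fls] have 1: "fps_to_fls log_L * (1 + fps_to_fls b_series * fps_to_fls (V oo b_series)) = fps_to_fls b_series"
    by (simp add: fls_times_fps_to_fls)
  have rb: "fps_to_fls b_series * recip b_series = 1" and rl: "fps_to_fls log_L * recip log_L = 1"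
    by (rule recip_mult; simp)+
  have "recip b_series + fps_to_fls (V oo b_series) = recip log_L"
    by (rule recip_algebra[OF 1 rb rl])
  then have H: "fps_to_fls (V oo b_series) = recip log_L - recip b_series"
    by (simp add: algebra_simps)
  have U: "eta_R ((thom_U \<circ> sigma) (Poly_Mapping.single l 1)) = fps_nth V (nat l)" if "l \<ge> 0" for l
    using that recip_unit_part[OF log v(1)]
    by (simp add: sigma_def semilinear_extension_single thom_U_def X_inv_nth V_def vR_def nat_add_distrib)
  have "extend_scalars_functional (thom_U \<circ> sigma) (E_tau (Poly_Mapping.single (int i, int j) 1)) =
     (\<Sum>l\<in>{0..int j}. - fls_nth (recip b_series) (int i) * fls_nth (int_power b_series l) (int j) * fps_nth V (nat l))"
    by (simp add: E_tau_single extend_scalars_functional_sum_singles U del: comp_apply)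
  also have "\<dots> = (\<Sum>l\<in>{0..j}. - fls_nth (recip b_series) (int i) * (fps_nth V l * fps_nth (b_series ^ l) j))"
    by (rule sum.reindex_bij_witness[of _ int nat])
       (auto simp: int_power_def simp flip: fps_to_fls_power)
  also have "\<dots> = - fls_nth (recip b_series) (int i) * fps_nth (V oo b_series) j"
    by (simp add: fps_compose_nth sum_distrib_left)
  also have "fps_nth (V oo b_series) j = fls_nth (recip log_L - recip b_series) (int j)"
    by (simp flip: H)
  also have "- fls_nth (recip b_series) (int i) = fls_nth (recip fps_X - recip b_series) (int i)"
  proof -
    have "recip (fps_X :: MUMUQ fps) = fls_X_inv * fps_to_fls 1"
      by (rule recip_unit_part) (auto simp: fps_eq_iff)
    then show ?thesis by simp
  qed
  finally show ?thesis .
qed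


lemma MU_zero: "0 \<in> MU" using MU_diff[OF MU_one MU_one] by simp
lemma MU_add: "x \<in> MU \<Longrightarrow> y \<in> MU \<Longrightarrow> x + y \<in> MU"
  using MU_diff[of x "0 - y"] MU_diff[OF MU_zero, of y] by simp
lemma MU_sum: "(\<And>a. a \<in> A \<Longrightarrow> f a \<in> MU) \<Longrightarrow> sum f A \<in> MU"
  by (induction A rule: infinite_finite_induct) (auto intro: MU_zero MU_add)
lemma MU_of_nat: "of_nat n \<in> MU"
  by (induction n) (auto intro: MU_zero MU_add MU_one)

lemma exp_MU_props: "fps_nth exp_MU 0 = 0" "fps_nth exp_MU 1 = 1" "log_MU oo exp_MU = fps_X" "exp_MU oo log_MU = fps_X"
  unfolding exp_MU_def by (intro comp_inverse_works; simp add: log_MU_def)+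

lemma log_MU_nth [simp]: "fps_nth log_MU 0 = 0" "fps_nth log_MU (Suc 0) = 1"
  by (simp_all add: log_MU_def)

lemma fgl_linear_coeff: fixes l :: "'a::comm_ring_1 fps"
  assumes that: "fps_nth l 0 = (0::'a)" "fps_nth l 1 = 1"
  shows "fps_nth ((fps_const (c::'a fps) + Abs_fps (\<lambda>n. fps_const (fps_nth l n))) ^ k) 1 = of_nat k * c ^ (k - 1)"
proof -
  let ?y = "fps_const c + Abs_fps (\<lambda>n. fps_const (fps_nth l n))"
  have 0: "fps_nth (?y ^ k) 0 = c ^ k" for k
    using that by (induction k) auto
  show ?thesis
  proof (induction k)
    case (Suc k)
    have "fps_nth (?y ^ Suc k) 1 = fps_nth ?y 0 * fps_nth (?y ^ k) 1 + fps_nth ?y 1 * fps_nth (?y ^ k) 0"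
      by (simp add: fps_mult_nth)
    also have "\<dots> = of_nat (Suc k) * c ^ k"
      using that unfolding Suc 0 by (cases k) (auto simp: algebra_simps)
    finally show ?case by simp
  qed simp
qed

lemma fgl_coeff_1: "fgl_coeff i 1 = fps_nth (fps_deriv exp_MU oo log_MU) i"
proof -
  have "fgl_coeff i 1 = (\<Sum>k\<le>i + 1. fps_nth exp_MU k * fps_nth (of_nat k * log_MU ^ (k - 1)) i)"
    unfolding fgl_coeff_def by (subst fgl_linear_coeff) auto
  also have "\<dots> = (\<Sum>k\<in>{0..i}. fps_nth exp_MU (Suc k) * (of_nat (Suc k) * fps_nth (log_MU ^ k) i))"
    using sum.atMost_Suc_shift[of "\<lambda>k. fps_nth exp_MU k * fps_nth (of_nat k * log_MU ^ (k - 1)) i" i]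
    by (simp add: fps_mult_of_nat_nth atMost_atLeast0 del: of_nat_Suc sum.atMost_Suc power_Suc sum.atLeast0_atMost_Suc)
  also have "\<dots> = fps_nth (fps_deriv exp_MU oo log_MU) i"
    by (simp add: fps_compose_nth algebra_simps)
  finally show ?thesis .
qed

lemma compose_exp_MU_integral:
  assumes "\<forall>k. fps_nth h k \<in> MU"
  shows "of_nat (fact n) * fps_nth (h oo exp_MU) n \<in> MU"
  using assms
proof (induction n arbitrary: h)
  case 0
  then show ?case by (simp)
next
  case (Suc n)
  define w where "w = fps_deriv exp_MU oo log_MU"
  have w: "fps_nth w k \<in> MU" for k
    using MU_coeff[of k 1] unfolding fgl_coeff_1 w_def .
  have "fps_deriv exp_MU = w oo exp_MU"
    unfolding w_def using exp_MU_props
    by (subst fps_compose_assoc[symmetric]) auto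
  then have d: "fps_deriv (h oo exp_MU) = (fps_deriv h * w) oo exp_MU"
    using exp_MU_props by (simp add: fps_compose_deriv fps_compose_mult_distrib)
  have "of_nat (fact (Suc n)) * fps_nth (h oo exp_MU) (Suc n) = of_nat (fact n) * fps_nth (fps_deriv (h oo exp_MU)) n"
    by (simp add: algebra_simps)
  also have "\<dots> \<in> MU" unfolding d
    by (rule Suc.IH) (auto simp: fps_mult_nth simp del: of_nat_Suc intro!: MU_sum MU_mult MU_of_nat w Suc.prems[rule_format])
  finally show ?case .
qed

lemma prim_in_MU_CP: "prim n \<in> MU_CP 0"
proof -
  have "of_nat (fact n) * fps_nth (exp_MU ^ i) n \<in> MU" for i
    using compose_exp_MU_integral[of "fps_X ^ i" n]
    using exp_MU_props by (auto simp: fps_compose_power[symmetric] fps_X_fps_compose_startby0 fps_X_power_nth MU_zero MU_one)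
  then show ?thesis
   unfolding MU_CP_def prim_def
   apply (auto simp: lookup_sum lookup_single when_def in_keys_iff intro!: MU_sum MU_zero split: if_splits elim!: sum.not_neutral_contains_not_neutral)
   done
qed

text \<open>This is the description of \<open>K\<close> by generating series: \<open>\<beta>(S) \<otimes> \<beta>(T)\<close> is sent to
  \<open>(1/S - 1/b(S)) (1/log\<^sup>L T - 1/b(T))\<close>.\<close>
lemma K_generators:
  "K (Poly_Mapping.single (int i, int j) 1) =
     fls_nth (recip fps_X - recip b_series) (int i) *
     fls_nth (recip log_L - recip b_series) (int j)"
proof -
  have "(Poly_Mapping.single (int i, int j) 1 :: (int \<times> int) \<Rightarrow>\<^sub>0 MUQ) \<in> MU_CP_CP 0 0"
    by (auto simp: MU_CP_CP_def lookup_single when_def MU_zero MU_one)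
  then show ?thesis
    unfolding K_def using K_generating_function[of i j] by (simp del: comp_apply)
qed

end

theory Submission
  imports Defs
begin

text \<open>\<open>K\<close> is linear over the left unit, and on the generators it is given by the product of the two
  series \<open>1/S - 1/b(S)\<close> and \<open>1/log\<^sup>L T - 1/b(T)\<close> in separate variables. The primitives are the
  coefficients of \<open>\<beta>(exp T)\<close> up to factorials, so evaluating \<open>K\<close> on them amounts to the substitutions
  \<open>S = exp\<^sup>L x\<close> and \<open>T = exp\<^sup>L y\<close>; it is \<open>exp\<^sup>L\<close> that occurs because scalars pass through \<open>K\<close>
  by way of the left unit (\<open>K_tensor_prim_sum\<close>, \<open>exp_L_coeffwise\<close>). Now
  \<open>b = exp\<^sup>R \<circ> log\<^sup>L\<close> gives \<open>b(exp\<^sup>L x) = exp\<^sup>R x\<close>, and the product becomes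
  \<open>(1/exp\<^sup>L x - 1/exp\<^sup>R x) (1/y - 1/exp\<^sup>R y)\<close>. Reversing the sign of both factors and
  adding and subtracting \<open>1/x\<close> in the first turns its coefficients into differences and values of
  Bernoulli numbers: the factor \<open>m!\<close> in the definition of the primitives meets the \<open>(m+1)!\<close>
  of the Bernoulli numbers and leaves \<open>1/(m+1)\<close>, which is why the reduced numbers appear.

  Each factor is a difference of two Laurent series whose poles cancel, so all the
  substitutions take place among power series (\<open>recip_diff_compose\<close>).\<close>

section \<open>Substitution into differences of reciprocals\<close>

text \<open>Both reciprocals are \<open>x\<^sup>-\<^sup>1\<close> times a power series with constant term \<open>1\<close>, so their principal parts
  cancel.\<close>
lemma recip_diff_is_fps:
  fixes f g :: "'a::idom fps"
  assumes f: "fps_nth f 0 = 0" "fps_nth f 1 = 1" and g: "fps_nth g 0 = 0" "fps_nth g 1 = 1"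
  obtains H where "recip f - recip g = fps_to_fls H"
proof -
  obtain v where v: "fps_shift 1 f * v = 1" "fps_nth v 0 = 1"
    using unit_part_inverse f(2) by blast
  obtain w where w: "fps_shift 1 g * w = 1" "fps_nth w 0 = 1"
    using unit_part_inverse g(2) by blast
  have "v - w = fps_X * fps_shift 1 (v - w)"
    by (rule fps_ext) (auto simp: v w)
  then have "fps_to_fls (v - w) = fls_X * fps_to_fls (fps_shift 1 (v - w))"
    by (metis fls_times_fps_to_fls fps_X_to_fls)
  moreover have "recip f - recip g = fls_X_inv * fps_to_fls (v - w)"
    by (simp add: recip_unit_part[OF f v(1)] recip_unit_part[OF g w(1)] right_diff_distrib)
  ultimately have "recip f - recip g = (fls_X_inv * fls_X) * fps_to_fls (fps_shift 1 (v - w))"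
    by (simp add: mult.assoc)
  then show thesis
    using that by (simp add: fls_X_times_conv_shift fls_X_inv_times_conv_shift)
qed

text \<open>Clearing denominators turns a statement about Laurent series into one about power series, which
  substitution preserves.\<close>
lemma recip_diff_eq_iff:
  fixes f g H :: "'a::idom fps"
  assumes f: "fps_nth f 0 = 0" "fps_nth f 1 = 1" and g: "fps_nth g 0 = 0" "fps_nth g 1 = 1"
  shows "recip f - recip g = fps_to_fls H \<longleftrightarrow> f * g * H = g - f"
proof -
  have nz: "fps_to_fls (f * g) \<noteq> 0" using f g by auto
  have "fps_to_fls (f * g) * (recip f - recip g)
      = (fps_to_fls f * recip f) * fps_to_fls g - (fps_to_fls g * recip g) * fps_to_fls f"
    by (simp add: fls_times_fps_to_fls algebra_simps)
  also have "\<dots> = fps_to_fls (g - f)"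
    by (simp only: recip_mult[OF f] recip_mult[OF g]) simp
  finally have 1: "fps_to_fls (f * g) * (recip f - recip g) = fps_to_fls (g - f)" .
  have "recip f - recip g = fps_to_fls H \<longleftrightarrow>
      fps_to_fls (f * g) * (recip f - recip g) = fps_to_fls (f * g) * fps_to_fls H"
    using nz by simp
  also have "\<dots> \<longleftrightarrow> fps_to_fls (g - f) = fps_to_fls (f * g * H)"
    unfolding 1 by (simp only: fls_times_fps_to_fls)
  finally show ?thesis by (simp only: fps_to_fls_eq_iff eq_commute)
qed

text \<open>Substituting \<open>e\<close> into \<open>1/f - 1/g\<close>: the right-hand side is the composition of power series, and
  it has the defining property \<open>(f \<circ> e) (g \<circ> e) H = g \<circ> e - f \<circ> e\<close> of the left-hand side.\<close>
lemma recip_diff_compose: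
  fixes f g e :: "'a::idom fps"
  assumes f: "fps_nth f 0 = 0" "fps_nth f 1 = 1" and g: "fps_nth g 0 = 0" "fps_nth g 1 = 1"
    and e: "fps_nth e 0 = 0" "fps_nth e 1 = 1"
  shows "fls_nth (recip (f oo e) - recip (g oo e)) (int n) =
    (\<Sum>i\<le>n. fls_nth (recip f - recip g) (int i) * fps_nth (e ^ i) n)"
proof -
  obtain H where H: "recip f - recip g = fps_to_fls H"
    using recip_diff_is_fps[OF f g] .
  then have "f * g * H = g - f"
    by (simp only: recip_diff_eq_iff[OF f g])
  then have "(f oo e) * (g oo e) * (H oo e) = (g oo e) - (f oo e)"
    by (metis fps_compose_mult_distrib[OF e(1)] fps_compose_sub_distrib)
  moreover have "fps_nth (f oo e) 0 = 0" "fps_nth (f oo e) 1 = 1"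
    "fps_nth (g oo e) 0 = 0" "fps_nth (g oo e) 1 = 1"
    using f g e by (simp_all add: fps_compose_nth)
  ultimately have "recip (f oo e) - recip (g oo e) = fps_to_fls (H oo e)"
    by (simp only: recip_diff_eq_iff)
  then show ?thesis
    by (simp add: H fps_compose_nth atMost_atLeast0)
qed

section \<open>Linearity of \<open>K\<close>\<close>

lemma semilinear_extension_smul:
  fixes h :: "'r::comm_ring_1 \<Rightarrow> 's::comm_ring_1" and f :: "'k \<Rightarrow> 'l \<Rightarrow>\<^sub>0 's"
  assumes "h 0 = 0" "\<And>a b. h (a * b) = h a * h b"
  shows "semilinear_extension h f (smul c z) = smul (h c) (semilinear_extension h f z)"
proof -
  have smul_sum: "smul d (sum g A) = (\<Sum>a\<in>A. smul d (g a))" for d :: 's and g :: "'k \<Rightarrow> 'l \<Rightarrow>\<^sub>0 's" and A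
    by (induction A rule: infinite_finite_induct) simp_all
  have smul_smul: "smul a (smul b x) = smul (a * b) x" for a b :: 's and x :: "'l \<Rightarrow>\<^sub>0 's"
    by (rule poly_mapping_eqI) (simp add: mult.assoc)
  have "Poly_Mapping.keys (smul c z) \<subseteq> Poly_Mapping.keys z"
    by (auto simp: in_keys_iff)
  then have "semilinear_extension h f (smul c z) =
      (\<Sum>k\<in>Poly_Mapping.keys z. smul (h (Poly_Mapping.lookup (smul c z) k)) (f k))"
    by (intro semilinear_extension_superset) (use assms in auto)
  then show ?thesis
    by (simp add: semilinear_extension_def assms smul_sum smul_smul)
qed

lemma E_tau_sum: "E_tau (sum g A) = (\<Sum>a\<in>A. E_tau (g a))"
  by (simp add: E_tau_def sigma'_def coaction_smash_def extend_scalars_def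
      semilinear_extension_sum flip: sum_negf)

lemma E_tau_smul: "E_tau (smul c z) = smul (eta_L c) (E_tau z)"
proof -
  have "- smul c x = smul c (- x)" for x :: "int \<times> int \<Rightarrow>\<^sub>0 MUQ"
    by (rule poly_mapping_eqI) simp
  then show ?thesis
    by (simp add: E_tau_def sigma'_def coaction_smash_def extend_scalars_def
        semilinear_extension_smul)
qed

lemma extend_scalars_functional_superset:
  assumes "finite A" "Poly_Mapping.keys z \<subseteq> A"
  shows "extend_scalars_functional f z =
    (\<Sum>k\<in>A. Poly_Mapping.lookup z k * eta_R (f (Poly_Mapping.single k 1)))"
  unfolding extend_scalars_functional_def
  by (rule sum.mono_neutral_left) (use assms in \<open>auto simp: in_keys_iff\<close>)

lemma extend_scalars_functional_add:
  "extend_scalars_functional f (x + y) = extend_scalars_functional f x + extend_scalars_functional f y"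
  using keys_add[of x y]
  by (simp add: extend_scalars_functional_superset[where A = "Poly_Mapping.keys x \<union> Poly_Mapping.keys y"]
      lookup_add sum.distrib distrib_right)

lemma extend_scalars_functional_sum:
  "extend_scalars_functional f (sum g A) = (\<Sum>a\<in>A. extend_scalars_functional f (g a))"
  by (induction A rule: infinite_finite_induct)
    (simp_all add: extend_scalars_functional_add, simp_all add: extend_scalars_functional_def)

lemma extend_scalars_functional_smul:
  "extend_scalars_functional f (smul c z) = c * extend_scalars_functional f z"
proof -
  have "Poly_Mapping.keys (smul c z) \<subseteq> Poly_Mapping.keys z"
    by (auto simp: in_keys_iff)
  then show ?thesis
    by (simp add: extend_scalars_functional_superset[where A = "Poly_Mapping.keys z"]
        sum_distrib_left mult.assoc)
qed

lemma tensor_in_MU_CP_CP: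
  assumes "x \<in> MU_CP m" "y \<in> MU_CP n"
  shows "tensor x y \<in> MU_CP_CP m n"
proof -
  have "Poly_Mapping.lookup (tensor x y) (k, l) = Poly_Mapping.lookup x k * Poly_Mapping.lookup y l" for k l
  proof -
    have "Poly_Mapping.lookup (tensor x y) (k, l) =
      (\<Sum>k'\<in>Poly_Mapping.keys x. if k' = k then
        (\<Sum>l'\<in>Poly_Mapping.keys y. if l' = l then Poly_Mapping.lookup x k * Poly_Mapping.lookup y l else 0) else 0)"
      unfolding tensor_def lookup_sum lookup_single when_def
      by (intro sum.cong refl) (auto intro: sum.neutral sum.cong)
    then show ?thesis by (simp only: sum.delta finite_keys) (simp add: in_keys_iff)
  qed
  then show ?thesis
    using assms by (auto simp: MU_CP_CP_def MU_CP_def in_keys_iff intro: MU_mult)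
qed

text \<open>The linearity used here is that of the composite which \<open>K\<close> restricts; it agrees with \<open>K\<close> at
  both ends because the primitives and the generators are integral.\<close>
lemma K_tensor_prim_sum:
  "K (tensor (prim m) (prim n)) =
    (\<Sum>i\<le>m. \<Sum>j\<le>n. eta_L (of_nat (fact m) * fps_nth (exp_MU ^ i) m *
       (of_nat (fact n) * fps_nth (exp_MU ^ j) n)) * K (Poly_Mapping.single (int i, int j) 1))"
proof -
  define f where "f = extend_scalars_functional (thom_U \<circ> sigma)"
  define p where "p n i = of_nat (fact n) * fps_nth (exp_MU ^ i) n" for n i
  have K: "K z = f (E_tau z)" if "z \<in> MU_CP_CP 0 0" for z
    using that by (simp add: K_def f_def)
  have prim: "prim n = (\<Sum>a\<in>int ` {..n}. Poly_Mapping.single a (p n (nat a)))" for n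
    by (simp add: prim_def p_def sum.reindex)
  have "tensor (prim m) (prim n) =
      (\<Sum>a\<in>int ` {..m}. \<Sum>b\<in>int ` {..n}. Poly_Mapping.single (a, b) (p m (nat a) * p n (nat b)))"
    unfolding prim by (intro tensor_sum_singles) auto
  also have "\<dots> = (\<Sum>i\<le>m. \<Sum>j\<le>n. smul (p m i * p n j) (Poly_Mapping.single (int i, int j) 1))"
    by (simp add: sum.reindex)
  finally have t: "tensor (prim m) (prim n) =
      (\<Sum>i\<le>m. \<Sum>j\<le>n. smul (p m i * p n j) (Poly_Mapping.single (int i, int j) 1))" .
  have "K (tensor (prim m) (prim n)) = f (E_tau (tensor (prim m) (prim n)))"
    by (intro K tensor_in_MU_CP_CP prim_in_MU_CP)
  also have "\<dots> = (\<Sum>i\<le>m. \<Sum>j\<le>n. eta_L (p m i * p n j) * f (E_tau (Poly_Mapping.single (int i, int j) 1)))"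
    unfolding t f_def
    by (simp only: E_tau_sum E_tau_smul extend_scalars_functional_sum extend_scalars_functional_smul)
  also have "\<dots> = (\<Sum>i\<le>m. \<Sum>j\<le>n. eta_L (p m i * p n j) * K (Poly_Mapping.single (int i, int j) 1))"
    by (intro sum.cong refl arg_cong2[where f = "(*)"] K[symmetric])
      (auto simp: MU_CP_CP_def lookup_single when_def MU_zero MU_one)
  finally show ?thesis unfolding p_def .
qed

section \<open>Exponentials and Bernoulli numbers\<close>

lemma eta_L_sum: "eta_L (sum f A) = (\<Sum>a\<in>A. eta_L (f a))"
  by (induction A rule: infinite_finite_induct) simp_all

lemma eta_L_of_nat: "eta_L (of_nat n) = of_nat n"
  by (induction n) simp_all

lemma power_coeffwise_eta_L:
  "fps_nth (Abs_fps (\<lambda>n. eta_L (fps_nth f n)) ^ k) n = eta_L (fps_nth (f ^ k) n)"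
  by (induction k arbitrary: n) (simp_all add: fps_mult_nth eta_L_sum)

lemma exp_L_inverse:
  "fps_nth exp_L 0 = 0" "fps_nth exp_L 1 = 1" "log_L oo exp_L = fps_X" "exp_L oo log_L = fps_X"
  unfolding exp_L_def by (intro comp_inverse_works; simp)+

text \<open>The left unit is a ring homomorphism that carries the logarithm to \<open>log\<^sup>L\<close>, hence its
  compositional inverse to \<open>exp\<^sup>L\<close>.\<close>
lemma exp_L_coeffwise: "exp_L = Abs_fps (\<lambda>n. eta_L (fps_nth exp_MU n))" (is "_ = ?e")
proof -
  have e0: "fps_nth ?e 0 = 0" by (simp add: exp_MU_props)
  have "log_L oo ?e = fps_X"
  proof (rule fps_ext)
    fix n
    have "fps_nth (log_L oo ?e) n = eta_L (fps_nth (log_MU oo exp_MU) n)"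
      by (simp add: fps_compose_nth power_coeffwise_eta_L eta_L_sum log_L_def)
    then show "fps_nth (log_L oo ?e) n = fps_nth fps_X n"
      by (simp add: exp_MU_props)
  qed
  then have "exp_L = exp_L oo (log_L oo ?e)" by simp
  also have "\<dots> = ?e"
    using e0 by (simp add: fps_compose_assoc exp_L_inverse fps_X_fps_compose_startby0)
  finally show ?thesis .
qed

lemma b_series_oo_exp_L: "b_series oo exp_L = exp_R"
proof -
  have "b_series oo exp_L = exp_R oo (log_L oo exp_L)"
    unfolding b_series_eq by (rule fps_compose_assoc[symmetric]) (simp_all add: exp_L_inverse)
  then show ?thesis by (simp add: exp_L_inverse)
qed

text \<open>The denominator \<open>m + 1\<close> of the reduced number cancels the last factor of \<open>(m + 1)!\<close>, which
  leaves the normalization \<open>m!\<close> of the primitives.\<close>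
lemma reduced_bernoulli_fgl_Suc:
  "reduced_bernoulli_fgl e (m + 1) = of_nat (fact m) * fls_nth (recip e - recip fps_X) (int m)"
proof -
  have "Poly_Mapping.single 0 (1 / of_nat (m + 1)) * of_nat (m + 1) = (1 :: MUQ)"
    by (simp add: mult_single del: of_nat_Suc of_nat_add flip: single_of_nat single_one)
  then have "eta_L (Poly_Mapping.single 0 (1 / of_nat (m + 1))) * of_nat (m + 1) = 1"
    by (metis eta_L_of_nat eta_L_simps(2,4))
  then have "eta_L (Poly_Mapping.single 0 (1 / of_nat (m + 1))) * of_nat (fact (m + 1)) = of_nat (fact m)"
    by (simp only: Suc_eq_plus1[symmetric] fact_Suc of_nat_mult of_nat_id mult.assoc[symmetric]) simp
  then show ?thesis
    by (simp add: reduced_bernoulli_fgl_def bernoulli_fgl_def mult.assoc[symmetric] del: fact_Suc)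
qed

theorem proposition5p8:
  fixes m n :: nat
  shows "K (tensor (prim m) (prim n)) =
    (reduced_bernoulli_fgl exp_R (m + 1) - reduced_bernoulli_fgl exp_L (m + 1)) *
     reduced_bernoulli_fgl exp_R (n + 1)"
proof -
  define F where "F = recip (fps_X :: MUMUQ fps) - recip b_series"
  define G where "G = recip log_L - recip b_series"
  \<comment> \<open>The substitutions \<open>S = exp\<^sup>L x\<close> and \<open>T = exp\<^sup>L y\<close>, read off in degrees \<open>m\<close> and \<open>n\<close>.\<close>
  have F: "(\<Sum>i\<le>m. fls_nth F (int i) * fps_nth (exp_L ^ i) m) = fls_nth (recip exp_L - recip exp_R) (int m)"
    using recip_diff_compose[of fps_X b_series exp_L m]
    by (simp add: F_def b_series_oo_exp_L exp_L_inverse exp_L_inverse(2)[unfolded One_nat_def] fps_X_fps_compose_startby0)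
  have G: "(\<Sum>j\<le>n. fls_nth G (int j) * fps_nth (exp_L ^ j) n) = fls_nth (recip fps_X - recip exp_R) (int n)"
    using recip_diff_compose[of log_L b_series exp_L n]
    by (simp add: G_def b_series_oo_exp_L exp_L_inverse exp_L_inverse(2)[unfolded One_nat_def])
  have e: "eta_L (fps_nth (exp_MU ^ i) k) = fps_nth (exp_L ^ i) k" for i k
    by (simp add: exp_L_coeffwise power_coeffwise_eta_L)
  have "K (tensor (prim m) (prim n)) =
      (\<Sum>i\<le>m. \<Sum>j\<le>n. (of_nat (fact m) * (fls_nth F (int i) * fps_nth (exp_L ^ i) m)) *
         (of_nat (fact n) * (fls_nth G (int j) * fps_nth (exp_L ^ j) n)))"
    unfolding K_tensor_prim_sum K_generators eta_L_simps eta_L_of_nat e F_def G_def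
    by (simp only: ac_simps)
  also have "\<dots> = (of_nat (fact m) * fls_nth (recip exp_L - recip exp_R) (int m)) *
      (of_nat (fact n) * fls_nth (recip fps_X - recip exp_R) (int n))"
    unfolding F[symmetric] G[symmetric]
    by (subst sum_product[symmetric]) (simp only: sum_distrib_left)
  also have "\<dots> = (reduced_bernoulli_fgl exp_R (m + 1) - reduced_bernoulli_fgl exp_L (m + 1)) *
      reduced_bernoulli_fgl exp_R (n + 1)"
    unfolding reduced_bernoulli_fgl_Suc by (simp add: algebra_simps)
  finally show ?thesis .
qed

end
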